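(* Let $L\ge 1$ be an integer, $\delta>0$, and let $G_+,G_->0$ be real numbers satisfying $G_+-G_-=2\delta$ or $G_+-G_-=-2\delta$. Let $H$ be the pairing Hamiltonian $$H=\sum_{j=1}^{L}\epsilon_j n_j-\sum_{j,k=1}^{L}G_{jk}\,c_{k+}^{\dagger}c_{k-}^{\dagger}c_{j-}c_{j+},\qquad \epsilon_j=\Big(j-\frac{L+1}{2}\Big)\delta,$$ with $G_{jk}=G_+$ for $j<k$, $G_{jk}=\tfrac12(G_++G_-)$ for $j=k$, and $G_{jk}=G_-$ for $j>k$. Let $\mathcal{S}=\{\delta(k-L/2):k=1,\dots,L-1\}$. (i) Let $M\ge 1$ and let $\mathcal{T}=\{v_1,\dots,v_M\}$ be a set of $M$ elements of $\mathcal{S}$ such that $|v_j-v_k|>\delta$ for each pair of distinct elements $v_j,v_k\in\mathcal{T}$. Then $$E=2\sum_{k=1}^{M}v_k$$ is an eigenvalue of the restriction of $H$ to the subspace of states with exactly $M$ pairs and no unpaired fermions (it is called the energy of a deconfined excitation). (ii) For $1\le M\le L/2$, the total number of deconfined excitations, i.e. the number of $M$-element sets $\mathcal{T}\subseteq\mathcal{S}$ with $|v_j-v_k|>\delta$ for all distinct $v_j,v_k\in\mathcal{T}$, is $$n(L,M)=\frac{(L-M)!}{(L-2M)!\,M!}.$$ (iii) Deconfined excitations do not occur for filling fractions $M/L$ greater than $1/2$, i.e. no such set $\mathcal{T}$ exists if $M>L/2$.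
   Context: The operators $c_{j\pm},c_{j\pm}^\dagger$ ($j=1,\dots,L$) are fermionic annihilation and creation operators satisfying the canonical anticommutation relations $\{c_{j\sigma},c_{k\tau}^\dagger\}=\delta_{jk}\delta_{\sigma\tau}$ (Kronecker deltas), $\{c_{j\sigma},c_{k\tau}\}=0$, acting on the $4^L$-dimensional fermionic Fock space with vacuum $|0\rangle$; $n_j=c_{j+}^\dagger c_{j+}+c_{j-}^\dagger c_{j-}$. The parameter $\delta>0$ is the level spacing. The subspace with exactly $M$ pairs and no unpaired fermions is the $\binom{L}{M}$-dimensional span of the vectors $b_{j_1}^\dagger\cdots b_{j_M}^\dagger|0\rangle$ with $1\le j_1<\dots<j_M\le L$, where $b_j^\dagger=c_{j+}^\dagger c_{j-}^\dagger$; it is invariant under $H$. On this subspace, with $b_j=c_{j-}c_{j+}$, one has $H=\sum_j 2\epsilon_j b_j^\dagger b_j-\sum_{j,k}G_{jk}b_k^\dagger b_j$. Deconfined excitations in the $M$-pair sector are labelled by the $M$-element subsets $\mathcal{T}$ of $\mathcal{S}$ whose distinct elements differ pairwise by more than $\delta$ in absolute value; the excitation labelled by $\mathcal{T}$ has energy $2\sum_{v\in\mathcal{T}}v$. *)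

theory Defs
  imports "HOL-Analysis.Analysis"
begin

datatype spin = Plus | Minus

definition dagger :: "complex^'n^'n \<Rightarrow> complex^'n^'n"  (\<open>_\<^sup>\<dagger>\<close> [1000] 999) where
  "A\<^sup>\<dagger> = (\<chi> r s. cnj (A $ s $ r))"

text \<open>
  The Fock space is \<open>complex^'n\<close>, where the finite type \<open>'n\<close> labels an orthonormal basis.
  Only the operators \<open>c j \<sigma>\<close> with \<open>1 \<le> j \<le> L\<close> are meaningful.
\<close>
locale fermionic_fock_space =
  fixes L :: nat
    and c :: "nat \<Rightarrow> spin \<Rightarrow> complex^'n^'n"
    and vac :: "complex^'n"
  assumes dimension: "CARD('n) = 4 ^ L"
    and anticomm_dagger: "\<lbrakk>j \<in> {1..L}; k \<in> {1..L}\<rbrakk> \<Longrightarrow>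
          c j \<sigma> ** (c k \<tau>)\<^sup>\<dagger> + (c k \<tau>)\<^sup>\<dagger> ** c j \<sigma> = (if j = k \<and> \<sigma> = \<tau> then mat 1 else 0)"
    and anticomm: "\<lbrakk>j \<in> {1..L}; k \<in> {1..L}\<rbrakk> \<Longrightarrow> c j \<sigma> ** c k \<tau> + c k \<tau> ** c j \<sigma> = 0"
    and vac_nonzero: "vac \<noteq> 0"
    and annihilates_vac: "j \<in> {1..L} \<Longrightarrow> c j \<sigma> *v vac = 0"

definition level_energy :: "nat \<Rightarrow> real \<Rightarrow> nat \<Rightarrow> real" where
  "level_energy L \<delta> j = (real j - (real L + 1) / 2) * \<delta>"

definition coupling :: "real \<Rightarrow> real \<Rightarrow> nat \<Rightarrow> nat \<Rightarrow> real" where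
  "coupling Gp Gm j k = (if j < k then Gp else if j = k then (Gp + Gm) / 2 else Gm)"

definition number_op :: "(nat \<Rightarrow> spin \<Rightarrow> complex^'n^'n) \<Rightarrow> nat \<Rightarrow> complex^'n^'n" where
  "number_op c j = (c j Plus)\<^sup>\<dagger> ** c j Plus + (c j Minus)\<^sup>\<dagger> ** c j Minus"

definition pairing_hamiltonian ::
  "nat \<Rightarrow> real \<Rightarrow> real \<Rightarrow> real \<Rightarrow> (nat \<Rightarrow> spin \<Rightarrow> complex^'n^'n) \<Rightarrow> complex^'n^'n" where
  "pairing_hamiltonian L \<delta> Gp Gm c =
     (\<Sum>j=1..L. level_energy L \<delta> j *\<^sub>R number_op c j)
     - (\<Sum>j=1..L. \<Sum>k=1..L. coupling Gp Gm j k *\<^sub>R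
          ((c k Plus)\<^sup>\<dagger> ** (c k Minus)\<^sup>\<dagger> ** c j Minus ** c j Plus))"

definition pair_creation :: "(nat \<Rightarrow> spin \<Rightarrow> complex^'n^'n) \<Rightarrow> nat \<Rightarrow> complex^'n^'n" where
  "pair_creation c j = (c j Plus)\<^sup>\<dagger> ** (c j Minus)\<^sup>\<dagger>"

definition pair_state ::
  "(nat \<Rightarrow> spin \<Rightarrow> complex^'n^'n) \<Rightarrow> complex^'n \<Rightarrow> nat list \<Rightarrow> complex^'n" where
  "pair_state c vac js = foldr (\<lambda>j \<psi>. pair_creation c j *v \<psi>) js vac"

text \<open>Here \<open>vec.span\<close> is the span over the scalar field, i.e. over the complex numbers.\<close>
definition pair_sector ::
  "nat \<Rightarrow> nat \<Rightarrow> (nat \<Rightarrow> spin \<Rightarrow> complex^'n^'n) \<Rightarrow> complex^'n \<Rightarrow> (complex^'n) set" where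
  "pair_sector L M c vac = vec.span
     {pair_state c vac js | js. length js = M \<and> sorted_wrt (<) js \<and> set js \<subseteq> {1..L}}"

definition eigenvalue_on :: "complex^'n^'n \<Rightarrow> (complex^'n) set \<Rightarrow> complex \<Rightarrow> bool" where
  "eigenvalue_on A V E \<longleftrightarrow> (\<exists>\<psi>\<in>V. \<psi> \<noteq> 0 \<and> A *v \<psi> = E *s \<psi>)"

definition excitation_values :: "nat \<Rightarrow> real \<Rightarrow> real set" where
  "excitation_values L \<delta> = {\<delta> * (real k - real L / 2) | k. k \<in> {1..L - 1}}"

definition deconfined_excitations :: "nat \<Rightarrow> real \<Rightarrow> nat \<Rightarrow> real set set" where
  "deconfined_excitations L \<delta> M =
     {T. T \<subseteq> excitation_values L \<delta> \<and> card T = M \<and> (\<forall>v\<in>T. \<forall>w\<in>T. v \<noteq> w \<longrightarrow> \<bar>v - w\<bar> > \<delta>)}"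

text \<open>
  The locale is consistent: with basis states labelled by the sets of occupied modes,
  the Jordan-Wigner operators satisfy its assumptions.
\<close>

definition jw_sign :: "nat \<Rightarrow> nat set \<Rightarrow> complex" where
  "jw_sign m A = (- 1) ^ card {x \<in> A. x < m}"

lemma jw_sign_square: "jw_sign m A * jw_sign m A = 1"
  by (simp add: jw_sign_def flip: power_mult_distrib)

lemma jw_sign_insert:
  assumes "finite A" "p \<notin> A"
  shows "jw_sign m (insert p A) = (if p < m then - jw_sign m A else jw_sign m A)"
proof -
  have "{x \<in> insert p A. x < m} = (if p < m then insert p {x \<in> A. x < m} else {x \<in> A. x < m})"
    by auto
  then show ?thesis using assms by (simp add: jw_sign_def)
qed

lemma jw_sign_remove:
  assumes "finite A" "p \<in> A"
  shows "jw_sign m (A - {p}) = (if p < m then - jw_sign m A else jw_sign m A)"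
  using jw_sign_insert[of "A - {p}" p m] assms by (auto simp: insert_absorb)

fun mode :: "nat \<Rightarrow> spin \<Rightarrow> nat" where
  "mode j Plus = 2 * j"
| "mode j Minus = 2 * j + 1"

lemma mode_eq_iff: "mode j \<sigma> = mode k \<tau> \<longleftrightarrow> j = k \<and> \<sigma> = \<tau>"
  by (cases \<sigma>; cases \<tau>) (auto, presburger+)

lemma fermionic_fock_space_exists:
  assumes card: "CARD('n) = 4 ^ L"
  shows "\<exists>(c :: nat \<Rightarrow> spin \<Rightarrow> complex^'n^'n) vac. fermionic_fock_space L c vac"
proof -
  define Q where "Q = {2..<2 * L + 2}"
  have "card (Pow Q) = CARD('n)"
    by (simp add: Q_def card_Pow card power_mult)
  then obtain f :: "'n \<Rightarrow> nat set" where f: "bij_betw f UNIV (Pow Q)"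
    by (metis finite finite_Pow_iff Q_def finite_atLeastLessThan finite_same_card_bij)
  define g where "g = inv_into UNIV f"
  have fQ: "f r \<subseteq> Q" for r
    using f by (auto simp: bij_betw_def)
  have fin: "finite (f r)" for r
    using fQ[of r] by (rule finite_subset) (simp add: Q_def)
  have fg: "f (g A) = A" if "A \<subseteq> Q" for A
    using f that unfolding g_def by (auto simp: bij_betw_def f_inv_into_f)
  have gf: "g (f r) = r" for r
    using f unfolding g_def by (auto simp: bij_betw_def)
  have eq_g: "r = g A \<longleftrightarrow> f r = A" if "A \<subseteq> Q" for r A
    using fg gf that by metis
  define a :: "nat \<Rightarrow> complex^'n^'n" where
    "a m = (\<chi> r s. if m \<in> f s \<and> r = g (f s - {m}) then jw_sign m (f s) else 0)" for m
  have a: "a m $ r $ s = (if m \<in> f s \<and> r = g (f s - {m}) then jw_sign m (f s) else 0)" for m r s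
    by (simp add: a_def)
  have ad: "(a m)\<^sup>\<dagger> $ r $ s =
      (if m \<notin> f s \<and> r = g (insert m (f s)) then jw_sign m (f s) else 0)" if "m \<in> Q" for m r s
  proof -
    have "(m \<in> f r \<and> s = g (f r - {m})) \<longleftrightarrow> (m \<notin> f s \<and> r = g (insert m (f s)))"
      using eq_g[of "f r - {m}" s] eq_g[of "insert m (f s)" r] fQ[of r] fQ[of s] that by blast
    moreover have "jw_sign m (f r) = jw_sign m (f s)" if "m \<notin> f s" "r = g (insert m (f s))"
      using that fg[of "insert m (f s)"] fQ[of s] \<open>m \<in> Q\<close> jw_sign_insert[OF fin that(1), of m]
      by auto
    ultimately show ?thesis
      by (auto simp: dagger_def a jw_sign_def)
  qed
  have collapse: "(\<Sum>t\<in>UNIV. X t * (if P \<and> t = u then y else 0)) = (if P then X u * y else 0)"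
    for X :: "'n \<Rightarrow> complex" and P u y
    by (cases P) (simp_all add: if_distrib cong: if_cong)
  have aa: "(a m ** a p) $ r $ s = (if p \<in> f s then a m $ r $ g (f s - {p}) * jw_sign p (f s) else 0)"
    for m p r s
    by (simp add: matrix_matrix_mult_def a[of p] collapse)
  have ada: "((a p)\<^sup>\<dagger> ** a m) $ r $ s =
      (if m \<in> f s then (a p)\<^sup>\<dagger> $ r $ g (f s - {m}) * jw_sign m (f s) else 0)" for m p r s
    by (simp add: matrix_matrix_mult_def a[of m] collapse)
  have aad: "(a m ** (a p)\<^sup>\<dagger>) $ r $ s =
      (if p \<notin> f s then a m $ r $ g (insert p (f s)) * jw_sign p (f s) else 0)"
    if "p \<in> Q" for m p r s
    by (simp add: matrix_matrix_mult_def ad[OF that] collapse)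
  have fgr: "f (g (f s - {p})) = f s - {p}" for s p
    using fQ[of s] by (intro fg) auto
  have fgi: "f (g (insert p (f s))) = insert p (f s)" if "p \<in> Q" for s p
    using fQ[of s] that by (intro fg) auto
  have car1: "a m ** (a p)\<^sup>\<dagger> + (a p)\<^sup>\<dagger> ** a m = (if m = p then mat 1 else 0)"
    if mp: "m \<in> Q" "p \<in> Q" for m p
  proof (cases "m = p")
    case True
    have "(a m ** (a m)\<^sup>\<dagger> + (a m)\<^sup>\<dagger> ** a m) $ r $ s = mat 1 $ r $ s" for r s
      by (auto simp: aad ada mp a ad fgr fgi jw_sign_square jw_sign_remove jw_sign_insert fin
          mat_def insert_absorb gf)
    with True show ?thesis by (simp add: vec_eq_iff)
  next
    case False
    have "insert p (f s) - {m} = insert p (f s - {m})" for s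
      using False by auto
    then have "(a m ** (a p)\<^sup>\<dagger> + (a p)\<^sup>\<dagger> ** a m) $ r $ s = 0" for r s
      using False
      by (auto simp: aad ada mp a ad fgr fgi jw_sign_remove jw_sign_insert fin)
    with False show ?thesis by (simp add: vec_eq_iff)
  qed
  have car2: "a m ** a p + a p ** a m = 0" if mp: "m \<in> Q" "p \<in> Q" for m p
  proof -
    have "f s - {p} - {m} = f s - {m} - {p}" for s
      by auto
    then have "(a m ** a p + a p ** a m) $ r $ s = 0" for r s
      by (auto simp: aa a fgr jw_sign_remove fin)
    then show ?thesis by (simp add: vec_eq_iff)
  qed
  define vac :: "complex^'n" where "vac = axis (g {}) 1"
  have "a m *v vac = 0" for m
  proof -
    have "a m $ r $ s * vac $ s = 0" for r s
      using fg[of "{}"] by (auto simp: vac_def axis_def a)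
    then show ?thesis by (auto simp: vec_eq_iff matrix_vector_mult_def intro!: sum.neutral)
  qed
  moreover have "vac \<noteq> 0"
    by (simp add: vac_def)
  moreover have "mode j \<sigma> \<in> Q" if "j \<in> {1..L}" for j \<sigma>
    using that by (cases \<sigma>) (auto simp: Q_def)
  ultimately have "fermionic_fock_space L (\<lambda>j \<sigma>. a (mode j \<sigma>)) vac"
    by unfold_locales (auto simp: card car1 car2 mode_eq_iff)
  then show ?thesis by blast
qed

end

(*
  Write B_m for the creator of a pair on level m. If Gp - Gm = - 2 delta, the dimer creators
  D_m = B_m - B_(m+1) satisfy H D_m x = D_m H x + (e_m + e_(m+1)) D_m x whenever the levels m and
  m + 1 are empty in x, and e_m + e_(m+1) is twice an element of the set S. So products of dimers
  on disjoint pairs of neighbouring levels, applied to the vacuum, are eigenvectors; disjointness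
  is the separation condition on the set T. If Gp - Gm = 2 delta, the adjoint of H is the
  Hamiltonian with Gp and Gm interchanged, and a real eigenvalue of the adjoint on the invariant
  finite-dimensional pair sector is an eigenvalue of H there.
*)
theory Submission
  imports Defs
begin

section \<open>Adjoints and restricted eigenvalues\<close>

lemma dagger_component: "A\<^sup>\<dagger> $ r $ s = cnj (A $ s $ r)"
  by (simp add: dagger_def)

lemma dagger_dagger [simp]: "(A\<^sup>\<dagger>)\<^sup>\<dagger> = A"
  by (simp add: vec_eq_iff dagger_component)

lemma dagger_zero [simp]: "0\<^sup>\<dagger> = 0"
  by (simp add: vec_eq_iff dagger_component)

lemma dagger_add: "(A + B)\<^sup>\<dagger> = A\<^sup>\<dagger> + B\<^sup>\<dagger>"
  by (simp add: vec_eq_iff dagger_component)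

lemma dagger_diff: "(A - B)\<^sup>\<dagger> = A\<^sup>\<dagger> - B\<^sup>\<dagger>"
  by (simp add: vec_eq_iff dagger_component)

lemma dagger_scaleR: "(r *\<^sub>R A)\<^sup>\<dagger> = r *\<^sub>R A\<^sup>\<dagger>"
  by (simp add: vec_eq_iff dagger_component)

lemma dagger_mult: "(A ** B)\<^sup>\<dagger> = B\<^sup>\<dagger> ** A\<^sup>\<dagger>"
  by (simp add: vec_eq_iff dagger_component matrix_matrix_mult_def mult.commute)

lemma dagger_sum: "(\<Sum>i\<in>I. A i)\<^sup>\<dagger> = (\<Sum>i\<in>I. (A i)\<^sup>\<dagger>)"
  by (induction I rule: infinite_finite_induct) (simp_all add: dagger_add)

lemma scaleR_matrix_vector: "(r *\<^sub>R A) *v x = r *\<^sub>R (A *v x)" for A :: "complex^'n^'m"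
  by (simp add: vec_eq_iff matrix_vector_mult_def scaleR_sum_right)

lemma matrix_vector_scaleR: "A *v (r *\<^sub>R x) = r *\<^sub>R (A *v x)" for A :: "complex^'n^'m"
  by (simp add: vec_eq_iff matrix_vector_mult_def scaleR_sum_right)

lemma matrix_vector_uminus: "A *v (- x) = - (A *v x)" for A :: "complex^'n^'m"
  by (simp add: vec_eq_iff matrix_vector_mult_def sum_negf)

lemma sum_matrix_vector: "(\<Sum>i\<in>I. A i) *v x = (\<Sum>i\<in>I. A i *v x)" for A :: "'i \<Rightarrow> complex^'n^'m"
  by (induction I rule: infinite_finite_induct) (simp_all add: matrix_vector_mult_add_rdistrib)

lemma matrix_vector_sum: "A *v (\<Sum>i\<in>I. x i) = (\<Sum>i\<in>I. A *v x i)" for A :: "complex^'n^'m"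
  by (induction I rule: infinite_finite_induct) (simp_all add: matrix_vector_right_distrib)

lemma scaleR_eq_smult: "r *\<^sub>R x = complex_of_real r *s x" for x :: "complex^'n"
  by (simp add: vec_eq_iff scaleR_conv_of_real[where 'a = complex])

lemma subspace_scaleR:
  fixes x :: "complex^'n"
  assumes "vec.subspace V" "x \<in> V"
  shows "r *\<^sub>R x \<in> V"
  using assms by (simp add: scaleR_eq_smult vec.subspace_scale)

text \<open>The preimage of a subspace under a linear map is a subspace, so it suffices to test
  generators. This reduces every later invariance claim to pair states.\<close>

lemma matrix_vector_mem_of_span:
  fixes A :: "complex^'n^'m"
  assumes "x \<in> vec.span G" "vec.subspace W" "\<And>g. g \<in> G \<Longrightarrow> A *v g \<in> W"
  shows "A *v x \<in> W"
  using assms(1)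
proof (induction rule: vec.span_induct_alt)
  case base
  show ?case using assms(2) by (simp add: vec.subspace_0)
next
  case (step a x y)
  then show ?case
    using assms(2,3) by (simp add: matrix_vector_right_distrib vector_scalar_commute
        vec.subspace_add vec.subspace_scale)
qed

text \<open>The sum is the Hermitian form, antilinear in \<open>x\<close>; the real-valued
  \<open>inner\<close> would give only its real part.\<close>

lemma dagger_adjoint:
  fixes x y :: "complex^'n"
  shows "(\<Sum>i\<in>UNIV. cnj (x $ i) * (A *v y) $ i) = (\<Sum>i\<in>UNIV. cnj ((A\<^sup>\<dagger> *v x) $ i) * y $ i)"
proof -
  have "(\<Sum>i\<in>UNIV. cnj (x $ i) * (A *v y) $ i) =
      (\<Sum>i\<in>UNIV. \<Sum>j\<in>UNIV. cnj (x $ i) * A $ i $ j * y $ j)"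
    by (simp add: matrix_vector_mult_def sum_distrib_left mult.assoc)
  also have "\<dots> = (\<Sum>j\<in>UNIV. \<Sum>i\<in>UNIV. cnj (x $ i) * A $ i $ j * y $ j)"
    by (rule sum.swap)
  also have "\<dots> = (\<Sum>i\<in>UNIV. cnj ((A\<^sup>\<dagger> *v x) $ i) * y $ i)"
    by (simp add: matrix_vector_mult_def dagger_component sum_distrib_left
        sum_distrib_right mult_ac)
  finally show ?thesis .
qed

text \<open>
  If \<open>A - E\<close> were injective on \<open>V\<close>, it would map \<open>V\<close> onto \<open>V\<close>; but its range is orthogonal
  to every eigenvector of the adjoint.
\<close>
lemma eigenvalue_on_of_dagger:
  fixes A :: "complex^'n^'n"
  assumes V: "vec.subspace V" and inv: "\<And>x. x \<in> V \<Longrightarrow> A *v x \<in> V"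
    and ev: "eigenvalue_on (A\<^sup>\<dagger>) V (cnj E)"
  shows "eigenvalue_on A V E"
proof (rule ccontr)
  assume no: "\<not> eigenvalue_on A V E"
  obtain \<psi> where \<psi>: "\<psi> \<in> V" "\<psi> \<noteq> 0" "A\<^sup>\<dagger> *v \<psi> = cnj E *s \<psi>"
    using ev by (auto simp: eigenvalue_on_def)
  define B where "B = A - mat E"
  have B: "B *v x = A *v x - E *s x" for x
  proof -
    have "mat E *v x = E *s x"
      by (simp add: vec_eq_iff matrix_vector_mult_def mat_def if_distrib if_distribR cong: if_cong)
    then show ?thesis by (simp add: B_def matrix_vector_mult_diff_rdistrib)
  qed
  have mem: "B *v x \<in> V" if "x \<in> V" for x
    using that V inv by (simp add: B vec.subspace_diff vec.subspace_scale)
  have inj: "inj_on ((*v) B) V"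
  proof (rule inj_onI)
    fix x y assume xy: "x \<in> V" "y \<in> V" "B *v x = B *v y"
    then have "B *v (x - y) = 0" by (simp add: matrix_vector_mult_diff_distrib)
    then have "A *v (x - y) = E *s (x - y)" by (simp add: B)
    moreover have "x - y \<in> V" using xy V by (simp add: vec.subspace_diff)
    ultimately show "x = y" using no by (auto simp: eigenvalue_on_def)
  qed
  have "(*v) B ` V = V"
  proof (rule vec.subspace_dim_equal)
    show "vec.subspace ((*v) B ` V)"
      using V by (rule vec.subspace_image)
    \<comment> \<open>An injective linear map preserves dimension, and a subspace of
      \<open>V\<close> with the dimension of \<open>V\<close> is all of \<open>V\<close>.\<close>
    show "vec.dim V \<le> vec.dim ((*v) B ` V)"
      using vec.dim_image_eq[of "(*v) B" V] inj V by (simp add: vec.span_eq_iff[THEN iffD2])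
  qed (use V mem in auto)
  \<comment> \<open>Now the eigenvector of the adjoint lies in the range of \<open>B\<close>, to
    which it is orthogonal; pairing it with itself must give 0.\<close>
  then obtain \<phi> where "\<psi> = B *v \<phi>"
    using \<psi>(1) by auto
  then have "(\<Sum>i\<in>UNIV. cnj (\<psi> $ i) * \<psi> $ i) =
      (\<Sum>i\<in>UNIV. cnj (\<psi> $ i) * (A *v \<phi>) $ i) - (\<Sum>i\<in>UNIV. cnj (\<psi> $ i) * (E * \<phi> $ i))"
    by (simp add: B right_diff_distrib sum_subtractf)
  \<comment> \<open>After moving \<open>A\<close> to the left factor, the eigenvalue
    \<open>cnj E\<close> is conjugated back to \<open>E\<close>, so the two sums coincide.\<close>
  also have "\<dots> = 0"
    unfolding dagger_adjoint \<psi>(3) by (simp add: mult.assoc mult.left_commute)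
  finally have "complex_of_real (\<Sum>i\<in>UNIV. (cmod (\<psi> $ i))\<^sup>2) = 0"
    by (simp add: complex_norm_square mult.commute del: of_real_power)
  then have "\<psi> = 0"
    unfolding of_real_eq_0_iff by (simp add: sum_nonneg_eq_0_iff vec_eq_iff)
  with \<psi>(2) show False by simp
qed


section \<open>Sets without consecutive elements\<close>

text \<open>These are the independent sets of size \<open>M\<close> in the path graph on the
  vertices 1 to \<open>n\<close>.\<close>

definition sparse_subsets :: "nat \<Rightarrow> nat \<Rightarrow> nat set set" where
  "sparse_subsets n M = {S. S \<subseteq> {1..n} \<and> card S = M \<and> (\<forall>i\<in>S. Suc i \<notin> S)}"

lemma finite_sparse_subsets: "finite (sparse_subsets n M)"
  by (rule finite_subset[of _ "Pow {1..n}"]) (auto simp: sparse_subsets_def)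

lemma finite_of_mem_sparse_subsets: "S \<in> sparse_subsets n M \<Longrightarrow> finite S"
  by (auto simp: sparse_subsets_def intro: finite_subset)

lemma sparse_subsets_0 [simp]: "sparse_subsets n 0 = {{}}"
  by (auto simp: sparse_subsets_def dest: finite_subset)

text \<open>Split by whether the largest vertex is chosen. If it is, its neighbour is excluded and
  the rest lives on the first \<open>n\<close> vertices.\<close>

lemma sparse_subsets_Suc_Suc:
  "sparse_subsets (Suc (Suc n)) (Suc M) =
    sparse_subsets (Suc n) (Suc M) \<union> insert (Suc (Suc n)) ` sparse_subsets n M"
proof (intro equalityI subsetI)
  fix S assume S: "S \<in> sparse_subsets (Suc (Suc n)) (Suc M)"
  then have fin: "finite S" by (rule finite_of_mem_sparse_subsets)
  have sub: "S \<subseteq> {1..Suc (Suc n)}" and card: "card S = Suc M" and sp: "\<forall>i\<in>S. Suc i \<notin> S"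
    using S by (auto simp: sparse_subsets_def)
  show "S \<in> sparse_subsets (Suc n) (Suc M) \<union> insert (Suc (Suc n)) ` sparse_subsets n M"
  proof (cases "Suc (Suc n) \<in> S")
    case True
    have "S - {Suc (Suc n)} \<subseteq> {1..n}"
    proof
      fix i assume i: "i \<in> S - {Suc (Suc n)}"
      then have "i \<noteq> Suc n" using sp True by auto
      with i sub show "i \<in> {1..n}" by force
    qed
    then have "S - {Suc (Suc n)} \<in> sparse_subsets n M"
      using sp card True fin by (auto simp: sparse_subsets_def)
    moreover have "S = insert (Suc (Suc n)) (S - {Suc (Suc n)})"
      using True by auto
    ultimately show ?thesis by blast
  next
    case False
    then have "S \<subseteq> {1..Suc n}" using sub by (force simp: le_Suc_eq)
    then show ?thesis using card sp by (simp add: sparse_subsets_def)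
  qed
next
  fix S assume "S \<in> sparse_subsets (Suc n) (Suc M) \<union> insert (Suc (Suc n)) ` sparse_subsets n M"
  then show "S \<in> sparse_subsets (Suc (Suc n)) (Suc M)"
  proof
    assume "S \<in> insert (Suc (Suc n)) ` sparse_subsets n M"
    then obtain R where R: "S = insert (Suc (Suc n)) R" "R \<in> sparse_subsets n M" by auto
    have "Suc (Suc n) \<notin> R" "Suc (Suc (Suc n)) \<notin> R" "Suc n \<notin> R"
      using R(2) by (auto simp: sparse_subsets_def)
    then show ?thesis
      using R finite_of_mem_sparse_subsets[OF R(2)] by (auto simp: sparse_subsets_def)
  qed (auto simp: sparse_subsets_def)
qed

text \<open>The recurrence for these sets is Pascal's rule along a diagonal. It reaches back two
  steps, hence the induction with two base cases.\<close>

lemma card_sparse_subsets: "card (sparse_subsets n M) = (Suc n - M) choose M"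
proof (induction n arbitrary: M rule: induct_nat_012)
  case 0
  show ?case
  proof (cases M)
    case (Suc K)
    then have "sparse_subsets 0 M = {}" by (auto simp: sparse_subsets_def)
    with Suc show ?thesis by simp
  qed simp
next
  case 1
  show ?case
  proof (cases M)
    case (Suc K)
    then have "S \<in> sparse_subsets (Suc 0) M \<longleftrightarrow> M = 1 \<and> S = {1}" for S
      by (cases "S = {}") (auto simp: sparse_subsets_def subset_singleton_iff)
    then have "sparse_subsets (Suc 0) M = (if M = 1 then {{1}} else {})"
      by (simp add: set_eq_iff)
    with Suc show ?thesis by simp
  qed simp
next
  case (ge2 n)
  show ?case
  proof (cases M)
    case (Suc K)
    have inj: "inj_on (insert (Suc (Suc n))) (sparse_subsets n K)"
      by (intro inj_onI, subst (asm) insert_ident) (auto simp: sparse_subsets_def)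
    have "card (sparse_subsets (Suc (Suc n)) M) =
        card (sparse_subsets (Suc n) (Suc K)) + card (insert (Suc (Suc n)) ` sparse_subsets n K)"
      unfolding Suc sparse_subsets_Suc_Suc
      by (intro card_Un_disjoint finite_imageI finite_sparse_subsets)
        (auto simp: sparse_subsets_def)
    also have "\<dots> = (Suc n - K choose Suc K) + (Suc n - K choose K)"
      using ge2.IH by (simp add: card_image[OF inj])
    \<comment> \<open>Pascal's rule when \<open>K\<close> is at most \<open>Suc n\<close>; for
      larger \<open>K\<close> the truncated differences are 0 and all three binomials
      vanish.\<close>
    also have "\<dots> = (Suc (Suc (Suc n)) - M choose M)"
      using Suc by (cases "K \<le> Suc n") (auto simp: Suc_diff_le not_le)
    finally show ?thesis .
  qed simp
qed

text \<open>The values are spaced by \<delta>, so a gap exceeding \<delta> means that the integer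
  indices differ by more than 1, that is, are neither equal nor adjacent.\<close>

lemma deconfined_excitations_eq:
  assumes "\<delta> > 0"
  shows "deconfined_excitations L \<delta> M =
    (\<lambda>S. (\<lambda>k. \<delta> * (real k - real L / 2)) ` S) ` sparse_subsets (L - 1) M"
proof -
  define v where "v k = \<delta> * (real k - real L / 2)" for k
  have inj: "inj v"
    using assms by (auto simp: v_def inj_def)
  have dist: "\<bar>v i - v k\<bar> > \<delta> \<longleftrightarrow> k \<noteq> i \<and> k \<noteq> Suc i \<and> i \<noteq> Suc k" for i k
  proof -
    have "\<bar>v i - v k\<bar> = \<delta> * \<bar>real i - real k\<bar>"
      using assms by (simp add: v_def abs_mult flip: right_diff_distrib)
    then have "\<bar>v i - v k\<bar> > \<delta> \<longleftrightarrow> \<bar>real i - real k\<bar> > 1"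
      using assms by simp
    also have "\<dots> \<longleftrightarrow> k \<noteq> i \<and> k \<noteq> Suc i \<and> i \<noteq> Suc k"
      by linarith
    finally show ?thesis .
  qed
  have vals: "excitation_values L \<delta> = v ` {1..L - 1}"
    by (auto simp: excitation_values_def v_def)
  have "deconfined_excitations L \<delta> M = (`) v ` sparse_subsets (L - 1) M"
  proof (intro equalityI subsetI)
    fix T assume T: "T \<in> deconfined_excitations L \<delta> M"
    then obtain S where S: "S \<subseteq> {1..L - 1}" "T = v ` S"
      by (auto simp: deconfined_excitations_def vals subset_image_iff)
    have "S \<in> sparse_subsets (L - 1) M"
      unfolding sparse_subsets_def
    proof (intro CollectI conjI ballI notI)
      show "card S = M"
        using T S(2) card_image[OF inj_on_subset[OF inj]] by (auto simp: deconfined_excitations_def)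
      fix i assume "i \<in> S" "Suc i \<in> S"
      then have "\<bar>v i - v (Suc i)\<bar> > \<delta>"
        using T S(2) inj by (auto simp: deconfined_excitations_def inj_eq)
      then show False by (simp add: dist)
    qed fact
    with S(2) show "T \<in> (`) v ` sparse_subsets (L - 1) M" by auto
  next
    fix T assume "T \<in> (`) v ` sparse_subsets (L - 1) M"
    then obtain S where S: "T = v ` S" "S \<in> sparse_subsets (L - 1) M" by auto
    have "\<bar>v i - v k\<bar> > \<delta>" if "i \<in> S" "k \<in> S" "v i \<noteq> v k" for i k
      using that S(2) by (auto simp: dist sparse_subsets_def)
    then show "T \<in> deconfined_excitations L \<delta> M"
      using S card_image[OF inj_on_subset[OF inj], of S]
      by (auto simp: deconfined_excitations_def vals sparse_subsets_def)
  qed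
  then show ?thesis by (simp add: v_def)
qed

text \<open>An injection acts injectively on sets. There are \<open>L - 1\<close> indices, and
  \<open>L >= 1\<close> turns \<open>Suc (L - 1)\<close> into \<open>L\<close> in the count.\<close>

lemma card_deconfined_excitations:
  assumes "\<delta> > 0" "L \<ge> 1"
  shows "card (deconfined_excitations L \<delta> M) = (L - M) choose M"
proof -
  have inj: "inj (\<lambda>k. \<delta> * (real k - real L / 2))"
    using assms by (auto simp: inj_def)
  then have "card (deconfined_excitations L \<delta> M) = card (sparse_subsets (L - 1) M)"
    unfolding deconfined_excitations_eq[OF assms(1)]
    by (intro card_image inj_onI) (simp add: inj_image_eq_iff)
  with assms show ?thesis by (simp add: card_sparse_subsets)
qed

text \<open>Infinite sets also have \<open>card\<close> 0, so concluding emptiness from a vanishing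
  count requires finiteness.\<close>

lemma finite_deconfined_excitations:
  "\<delta> > 0 \<Longrightarrow> finite (deconfined_excitations L \<delta> M)"
  by (simp add: deconfined_excitations_eq finite_sparse_subsets)


section \<open>The pairing Hamiltonian on paired states\<close>

lemmas matrix_vector_linear =
  matrix_vector_right_distrib matrix_vector_mult_diff_distrib matrix_vector_uminus
  matrix_vector_scaleR

lemma pair_creation_apply: "pair_creation c j *v x = (c j Plus)\<^sup>\<dagger> *v ((c j Minus)\<^sup>\<dagger> *v x)"
  by (simp add: pair_creation_def matrix_vector_mul_assoc)

lemma pair_annihilation_apply: "(pair_creation c j)\<^sup>\<dagger> *v x = c j Minus *v (c j Plus *v x)"
  by (simp add: pair_creation_def dagger_mult matrix_vector_mul_assoc)

lemma number_op_apply: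
  "number_op c j *v x = (c j Plus)\<^sup>\<dagger> *v (c j Plus *v x) + (c j Minus)\<^sup>\<dagger> *v (c j Minus *v x)"
  by (simp add: number_op_def matrix_vector_mul_assoc matrix_vector_mult_add_rdistrib)

text \<open>Each hopping term becomes a pair creator after a pair annihilator, so only the
  commutators of number operators and pair operators enter below.\<close>

lemma pairing_hamiltonian_apply:
  "pairing_hamiltonian L \<delta> Gp Gm c *v x =
     (\<Sum>j=1..L. level_energy L \<delta> j *\<^sub>R (number_op c j *v x))
     - (\<Sum>j=1..L. \<Sum>k=1..L. coupling Gp Gm j k *\<^sub>R
          (pair_creation c k *v ((pair_creation c j)\<^sup>\<dagger> *v x)))"
  by (simp add: pairing_hamiltonian_def matrix_vector_mult_diff_rdistrib sum_matrix_vector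
      scaleR_matrix_vector pair_creation_apply pair_annihilation_apply
      flip: matrix_vector_mul_assoc)

text \<open>The adjoint reverses each hop. Relabelling the double sum then transposes the coupling
  matrix, which exchanges \<open>Gp\<close> and \<open>Gm\<close> and fixes the averaged
  diagonal.\<close>

lemma dagger_pairing_hamiltonian:
  "(pairing_hamiltonian L \<delta> Gp Gm c)\<^sup>\<dagger> = pairing_hamiltonian L \<delta> Gm Gp c"
proof -
  have number: "(number_op c j)\<^sup>\<dagger> = number_op c j" for j
    by (simp add: number_op_def dagger_add dagger_mult)
  have coupling: "coupling Gm Gp k j = coupling Gp Gm j k" for j k
    by (auto simp: coupling_def)
  have "(\<Sum>j=1..L. \<Sum>k=1..L. coupling Gp Gm j k *\<^sub>R
          ((c j Plus)\<^sup>\<dagger> ** ((c j Minus)\<^sup>\<dagger> ** (c k Minus ** c k Plus)))) =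
        (\<Sum>k=1..L. \<Sum>j=1..L. coupling Gp Gm j k *\<^sub>R
          ((c j Plus)\<^sup>\<dagger> ** ((c j Minus)\<^sup>\<dagger> ** (c k Minus ** c k Plus))))"
    by (rule sum.swap)
  then show ?thesis
    by (simp add: pairing_hamiltonian_def dagger_diff dagger_sum dagger_scaleR dagger_mult number
        coupling flip: matrix_mul_assoc)
qed

context fermionic_fock_space
begin

section \<open>Commutation relations of fermions and pairs, applied to vectors\<close>

lemma annihilate_create:
  assumes "j \<in> {1..L}" "k \<in> {1..L}"
  shows "c j \<sigma> *v ((c k \<tau>)\<^sup>\<dagger> *v x) =
    (if j = k \<and> \<sigma> = \<tau> then x else 0) - (c k \<tau>)\<^sup>\<dagger> *v (c j \<sigma> *v x)"
proof -
  have "c j \<sigma> *v ((c k \<tau>)\<^sup>\<dagger> *v x) + (c k \<tau>)\<^sup>\<dagger> *v (c j \<sigma> *v x) = (if j = k \<and> \<sigma> = \<tau> then x else 0)"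
    using arg_cong[OF anticomm_dagger[OF assms, of \<sigma> \<tau>], of "\<lambda>A. A *v x"]
    by (simp add: matrix_vector_mult_add_rdistrib matrix_vector_mul_assoc split: if_splits)
  then show ?thesis by (simp add: eq_diff_eq)
qed

lemma create_create:
  assumes "j \<in> {1..L}" "k \<in> {1..L}"
  shows "(c j \<sigma>)\<^sup>\<dagger> *v ((c k \<tau>)\<^sup>\<dagger> *v x) = - ((c k \<tau>)\<^sup>\<dagger> *v ((c j \<sigma>)\<^sup>\<dagger> *v x))"
proof -
  \<comment> \<open>This is the adjoint of \<open>anticomm\<close>; the indices are swapped there
    because \<open>dagger\<close> reverses products.\<close>
  have "(c j \<sigma>)\<^sup>\<dagger> ** (c k \<tau>)\<^sup>\<dagger> + (c k \<tau>)\<^sup>\<dagger> ** (c j \<sigma>)\<^sup>\<dagger> = 0"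
    using arg_cong[OF anticomm[OF assms(2,1), of \<tau> \<sigma>], of dagger]
    by (simp add: dagger_add dagger_mult)
  from arg_cong[OF this, of "\<lambda>A. A *v x"] show ?thesis
    by (simp add: matrix_vector_mult_add_rdistrib matrix_vector_mul_assoc eq_neg_iff_add_eq_0)
qed

lemma create_twice: "j \<in> {1..L} \<Longrightarrow> (c j \<sigma>)\<^sup>\<dagger> *v ((c j \<sigma>)\<^sup>\<dagger> *v x) = 0"
  using create_create[of j j \<sigma> \<sigma> x] by (simp add: vec_eq_iff)

text \<open>Passing the two creators of a pair produces two signs, which cancel: pairs commute with
  the operators of other levels.\<close>

lemma annihilate_pair_creation:
  assumes "j \<in> {1..L}" "k \<in> {1..L}" "j \<noteq> k"
  shows "c j \<sigma> *v (pair_creation c k *v x) = pair_creation c k *v (c j \<sigma> *v x)"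
  using assms by (simp add: pair_creation_apply annihilate_create matrix_vector_linear)

lemma create_pair_creation:
  assumes "j \<in> {1..L}" "k \<in> {1..L}"
  shows "(c j \<sigma>)\<^sup>\<dagger> *v (pair_creation c k *v x) = pair_creation c k *v ((c j \<sigma>)\<^sup>\<dagger> *v x)"
  using assms
  by (simp add: pair_creation_apply create_create[of j k] matrix_vector_linear)

lemma pair_creation_commute:
  assumes "j \<in> {1..L}" "k \<in> {1..L}"
  shows "pair_creation c j *v (pair_creation c k *v x) =
    pair_creation c k *v (pair_creation c j *v x)"
  unfolding pair_creation_apply[of c j]
  by (simp only: create_pair_creation[OF assms])

lemma pair_creation_twice:
  assumes "j \<in> {1..L}"
  shows "pair_creation c j *v (pair_creation c j *v x) = 0"
proof -
  have "(c j Minus)\<^sup>\<dagger> *v (pair_creation c j *v x) = 0"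
    unfolding create_pair_creation[OF assms assms]
    by (simp add: pair_creation_apply create_twice[OF assms])
  then show ?thesis by (simp add: pair_creation_apply[of c j "pair_creation c j *v x"])
qed

lemma annihilate_Plus_pair_creation:
  assumes "j \<in> {1..L}"
  shows "c j Plus *v (pair_creation c j *v x) =
    (c j Minus)\<^sup>\<dagger> *v x + pair_creation c j *v (c j Plus *v x)"
  using assms by (simp add: pair_creation_apply annihilate_create matrix_vector_linear)

lemma annihilate_Minus_pair_creation:
  assumes "j \<in> {1..L}"
  shows "c j Minus *v (pair_creation c j *v x) =
    pair_creation c j *v (c j Minus *v x) - (c j Plus)\<^sup>\<dagger> *v x"
  using assms by (simp add: pair_creation_apply annihilate_create matrix_vector_linear)

text \<open>A pair carries two fermions, hence the factor 2 in the commutator on equal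
  levels.\<close>

lemma number_op_pair_creation:
  assumes "j \<in> {1..L}" "k \<in> {1..L}"
  shows "number_op c j *v (pair_creation c k *v x) =
    pair_creation c k *v (number_op c j *v x) + (if j = k then 2 *\<^sub>R (pair_creation c j *v x) else 0)"
proof (cases "j = k")
  case True
  have "(c j Minus)\<^sup>\<dagger> *v ((c j Plus)\<^sup>\<dagger> *v x) = - (pair_creation c j *v x)"
    unfolding pair_creation_apply using assms by (simp add: create_create[of j j Minus Plus])
  moreover have "(c j Plus)\<^sup>\<dagger> *v ((c j Minus)\<^sup>\<dagger> *v x) = pair_creation c j *v x"
    by (simp add: pair_creation_apply)
  ultimately show ?thesis
    using assms True
    by (simp add: number_op_apply annihilate_Plus_pair_creation annihilate_Minus_pair_creation
        create_pair_creation matrix_vector_linear scaleR_2)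
next
  case False
  then show ?thesis
    using assms by (simp add: number_op_apply annihilate_pair_creation create_pair_creation
        matrix_vector_linear)
qed

text \<open>Pairs are hard-core bosons: on one level the commutator is the identity minus the number
  operator, which reduces to the identity where the level is empty.\<close>

lemma pair_annihilation_pair_creation:
  assumes "j \<in> {1..L}" "k \<in> {1..L}"
  shows "(pair_creation c j)\<^sup>\<dagger> *v (pair_creation c k *v x) =
    pair_creation c k *v ((pair_creation c j)\<^sup>\<dagger> *v x) +
    (if j = k then x - number_op c j *v x else 0)"
proof (cases "j = k")
  case True
  then show ?thesis
    using assms
    by (simp add: pair_annihilation_apply annihilate_Plus_pair_creation
        annihilate_Minus_pair_creation annihilate_create number_op_apply matrix_vector_linear)
next
  case False
  then show ?thesis
    using assms by (simp add: pair_annihilation_apply annihilate_pair_creation)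
qed

text \<open>Emptiness is expressed by annihilation rather than by basis states, so it passes to
  linear combinations such as dimer states.\<close>

definition unoccupied :: "nat \<Rightarrow> complex^'n \<Rightarrow> bool" where
  "unoccupied j x \<longleftrightarrow> (\<forall>\<sigma>. c j \<sigma> *v x = 0)"

lemma unoccupied_vac: "j \<in> {1..L} \<Longrightarrow> unoccupied j vac"
  by (simp add: unoccupied_def annihilates_vac)

lemma unoccupied_number_op: "unoccupied j x \<Longrightarrow> number_op c j *v x = 0"
  by (simp add: unoccupied_def number_op_apply)

lemma unoccupied_pair_annihilation: "unoccupied j x \<Longrightarrow> (pair_creation c j)\<^sup>\<dagger> *v x = 0"
  by (simp add: unoccupied_def pair_annihilation_apply)

lemma unoccupied_pair_creation:
  "\<lbrakk>j \<in> {1..L}; k \<in> {1..L}; j \<noteq> k; unoccupied j x\<rbrakk> \<Longrightarrow> unoccupied j (pair_creation c k *v x)"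
  by (simp add: unoccupied_def annihilate_pair_creation)

lemma unoccupied_diff: "\<lbrakk>unoccupied j x; unoccupied j y\<rbrakk> \<Longrightarrow> unoccupied j (x - y)"
  by (simp add: unoccupied_def matrix_vector_mult_diff_distrib)


section \<open>Action of pair and number operators on pair states\<close>

lemma pair_state_Nil [simp]: "pair_state c vac [] = vac"
  by (simp add: pair_state_def)

lemma pair_state_Cons [simp]:
  "pair_state c vac (k # js) = pair_creation c k *v pair_state c vac js"
  by (simp add: pair_state_def)

text \<open>Pair creators commute, so the new one can be moved to its sorted place, and a repeated
  one squares to zero. Using \<open>insort\<close> keeps the result among the generators of the
  sector.\<close>

lemma pair_creation_pair_state:
  assumes "k \<in> {1..L}" "set js \<subseteq> {1..L}"
  shows "pair_creation c k *v pair_state c vac js =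
    (if k \<in> set js then 0 else pair_state c vac (insort k js))"
  using assms(2)
proof (induction js)
  case (Cons j js)
  then have j: "j \<in> {1..L}" by simp
  show ?case
  proof (cases "k = j")
    case True
    then show ?thesis using j by (simp add: pair_creation_twice)
  next
    case False
    then show ?thesis
      using Cons j assms(1) pair_creation_commute[of k j "pair_state c vac js"] by auto
  qed
qed simp

lemma unoccupied_pair_state:
  assumes "k \<in> {1..L}" "set js \<subseteq> {1..L}" "k \<notin> set js"
  shows "unoccupied k (pair_state c vac js)"
  using assms(2,3)
  by (induction js) (use assms(1) in \<open>auto intro: unoccupied_vac unoccupied_pair_creation\<close>)

text \<open>The annihilator moves right until it meets its own level. By distinctness that level is
  empty in the tail, so the commutator acts there as the identity.\<close>

lemma pair_annihilation_pair_state: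
  assumes "k \<in> {1..L}" "set js \<subseteq> {1..L}" "distinct js"
  shows "(pair_creation c k)\<^sup>\<dagger> *v pair_state c vac js =
    (if k \<in> set js then pair_state c vac (remove1 k js) else 0)"
  using assms(2,3)
proof (induction js)
  case Nil
  then show ?case using assms(1) by (simp add: unoccupied_pair_annihilation unoccupied_vac)
next
  case (Cons j js)
  then show ?case
    using assms(1) unoccupied_number_op[OF unoccupied_pair_state[of k js]]
    by (auto simp: pair_annihilation_pair_creation)
qed

lemma number_op_pair_state:
  assumes "k \<in> {1..L}" "set js \<subseteq> {1..L}" "distinct js"
  shows "number_op c k *v pair_state c vac js = (if k \<in> set js then 2 *\<^sub>R pair_state c vac js else 0)"
  using assms(2,3)
proof (induction js)
  case Nil
  then show ?case using assms(1) by (simp add: unoccupied_number_op unoccupied_vac)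
next
  case (Cons j js)
  then show ?case
    using assms(1) by (auto simp: number_op_pair_creation matrix_vector_scaleR)
qed

section \<open>Invariance of the pair sector\<close>

lemma subspace_pair_sector: "vec.subspace (pair_sector L M c vac)"
  by (simp add: pair_sector_def)

lemma pair_state_mem_pair_sector:
  assumes "sorted_wrt (<) js" "set js \<subseteq> {1..L}"
  shows "pair_state c vac js \<in> pair_sector L (length js) c vac"
  using assms unfolding pair_sector_def by (intro vec.span_base) blast

lemma matrix_vector_mem_of_pair_sector:
  assumes "x \<in> pair_sector L M c vac" "vec.subspace W"
    and "\<And>js. \<lbrakk>length js = M; sorted_wrt (<) js; set js \<subseteq> {1..L}\<rbrakk> \<Longrightarrow> A *v pair_state c vac js \<in> W"
  shows "A *v x \<in> W"
  using assms(1,2) unfolding pair_sector_def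
  by (rule matrix_vector_mem_of_span) (use assms(3) in auto)

lemma pair_creation_mem_pair_sector:
  assumes "x \<in> pair_sector L M c vac" "k \<in> {1..L}"
  shows "pair_creation c k *v x \<in> pair_sector L (Suc M) c vac"
  using assms(1) subspace_pair_sector
proof (rule matrix_vector_mem_of_pair_sector)
  fix js assume js: "length js = M" "sorted_wrt (<) js" "set js \<subseteq> {1..L}"
  show "pair_creation c k *v pair_state c vac js \<in> pair_sector L (Suc M) c vac"
  proof (cases "k \<in> set js")
    case True
    then show ?thesis
      using assms(2) js by (simp add: pair_creation_pair_state vec.subspace_0 subspace_pair_sector)
  next
    case False
    have "pair_state c vac (insort k js) \<in> pair_sector L (length (insort k js)) c vac"
      using js assms(2) False
      by (intro pair_state_mem_pair_sector)
        (auto simp: strict_sorted_iff sorted_insort distinct_insort set_insort_key)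
    then show ?thesis using assms(2) js False by (simp add: pair_creation_pair_state)
  qed
qed

lemma pair_annihilation_mem_pair_sector:
  assumes "x \<in> pair_sector L (Suc M) c vac" "k \<in> {1..L}"
  shows "(pair_creation c k)\<^sup>\<dagger> *v x \<in> pair_sector L M c vac"
  using assms(1) subspace_pair_sector
proof (rule matrix_vector_mem_of_pair_sector)
  fix js assume js: "length js = Suc M" "sorted_wrt (<) js" "set js \<subseteq> {1..L}"
  then have dist: "distinct js" by (simp add: strict_sorted_iff)
  show "(pair_creation c k)\<^sup>\<dagger> *v pair_state c vac js \<in> pair_sector L M c vac"
  proof (cases "k \<in> set js")
    case True
    have "pair_state c vac (remove1 k js) \<in> pair_sector L (length (remove1 k js)) c vac"
      using js by (intro pair_state_mem_pair_sector)
        (auto simp: strict_sorted_iff sorted_remove1 dest: set_remove1_subset[THEN subsetD])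
    then show ?thesis
      using assms(2) js dist True by (simp add: pair_annihilation_pair_state length_remove1)
  next
    case False
    then show ?thesis
      using assms(2) js dist
      by (simp add: pair_annihilation_pair_state vec.subspace_0 subspace_pair_sector)
  qed
qed

lemma number_op_mem_pair_sector:
  assumes "x \<in> pair_sector L M c vac" "k \<in> {1..L}"
  shows "number_op c k *v x \<in> pair_sector L M c vac"
  using assms(1) subspace_pair_sector
proof (rule matrix_vector_mem_of_pair_sector)
  fix js assume js: "length js = M" "sorted_wrt (<) js" "set js \<subseteq> {1..L}"
  then show "number_op c k *v pair_state c vac js \<in> pair_sector L M c vac"
    using assms(2) pair_state_mem_pair_sector[of js]
    by (simp add: number_op_pair_state strict_sorted_iff vec.subspace_0 subspace_pair_sector
        subspace_scaleR)
qed

text \<open>Every hopping term passes through the sector with one pair fewer, so \<open>M\<close> is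
  written as a successor.\<close>

lemma pairing_hamiltonian_mem_pair_sector:
  assumes "x \<in> pair_sector L M c vac" "M \<ge> 1"
  shows "pairing_hamiltonian L \<delta> Gp Gm c *v x \<in> pair_sector L M c vac"
proof -
  obtain K where "M = Suc K" using assms(2) by (cases M) auto
  with assms(1) show ?thesis
    unfolding pairing_hamiltonian_apply
    by (auto intro!: vec.subspace_diff vec.subspace_sum subspace_scaleR subspace_pair_sector
        number_op_mem_pair_sector pair_creation_mem_pair_sector pair_annihilation_mem_pair_sector)
qed

section \<open>Dimers on neighbouring levels and their eigenvalues\<close>

definition dimer_creation :: "nat \<Rightarrow> complex^'n^'n" where
  "dimer_creation m = pair_creation c m - pair_creation c (Suc m)"

lemma dimer_creation_apply:
  "dimer_creation m *v x = pair_creation c m *v x - pair_creation c (Suc m) *v x"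
  by (simp add: dimer_creation_def matrix_vector_mult_diff_rdistrib)

text \<open>Emptiness of both levels removes the number operators from the commutators, leaving
  \<open>x\<close> with the two signs of the dimer.\<close>

lemma pair_annihilation_dimer_creation:
  assumes "m \<in> {1..L}" "Suc m \<in> {1..L}" "unoccupied m x" "unoccupied (Suc m) x" "j \<in> {1..L}"
  shows "(pair_creation c j)\<^sup>\<dagger> *v (dimer_creation m *v x) =
    dimer_creation m *v ((pair_creation c j)\<^sup>\<dagger> *v x)
    + ((if j = m then x else 0) - (if j = Suc m then x else 0))"
  using assms
  by (auto simp: dimer_creation_apply matrix_vector_mult_diff_distrib
      pair_annihilation_pair_creation unoccupied_number_op)

lemma number_op_dimer_creation:
  assumes "m \<in> {1..L}" "Suc m \<in> {1..L}" "j \<in> {1..L}"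
  shows "number_op c j *v (dimer_creation m *v x) =
    dimer_creation m *v (number_op c j *v x)
    + ((if j = m then 2 *\<^sub>R (pair_creation c m *v x) else 0)
       - (if j = Suc m then 2 *\<^sub>R (pair_creation c (Suc m) *v x) else 0))"
  using assms
  by (auto simp: dimer_creation_apply matrix_vector_mult_diff_distrib number_op_pair_creation)

lemma pair_creation_dimer_creation:
  assumes "m \<in> {1..L}" "Suc m \<in> {1..L}" "k \<in> {1..L}"
  shows "pair_creation c k *v (dimer_creation m *v x) = dimer_creation m *v (pair_creation c k *v x)"
  using assms
  by (simp add: dimer_creation_apply matrix_vector_mult_diff_distrib pair_creation_commute[of k])

text \<open>
  Outside the dimer the amplitudes for leaving its two sites are equal and cancel; on the dimer
  the difference \<open>Gp - Gm = - 2 \<delta>\<close> compensates the level spacing.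
\<close>
lemma pairing_hamiltonian_dimer_creation:
  assumes m: "m \<in> {1..L}" "Suc m \<in> {1..L}" and un: "unoccupied m x" "unoccupied (Suc m) x"
    and G: "Gp - Gm = - 2 * \<delta>"
  shows "pairing_hamiltonian L \<delta> Gp Gm c *v (dimer_creation m *v x) =
    dimer_creation m *v (pairing_hamiltonian L \<delta> Gp Gm c *v x)
    + (2 * (\<delta> * (real m - real L / 2))) *\<^sub>R (dimer_creation m *v x)"
proof -
  let ?D = "dimer_creation m" and ?B = "pair_creation c" and ?A = "\<lambda>j. (pair_creation c j)\<^sup>\<dagger>"
  let ?e = "level_energy L \<delta>" and ?G = "coupling Gp Gm"
  have diag: "(\<Sum>j=1..L. ?e j *\<^sub>R (number_op c j *v (?D *v x))) =
      ?D *v (\<Sum>j=1..L. ?e j *\<^sub>R (number_op c j *v x))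
      + ((2 * ?e m) *\<^sub>R (?B m *v x) - (2 * ?e (Suc m)) *\<^sub>R (?B (Suc m) *v x))"
  proof -
    have "(\<Sum>j=1..L. ?e j *\<^sub>R (number_op c j *v (?D *v x))) =
      (\<Sum>j=1..L. ?D *v (?e j *\<^sub>R (number_op c j *v x))
       + ((if j = m then (2 * ?e m) *\<^sub>R (?B m *v x) else 0)
       - (if j = Suc m then (2 * ?e (Suc m)) *\<^sub>R (?B (Suc m) *v x) else 0)))"
      using m by (intro sum.cong refl)
        (auto simp: number_op_dimer_creation matrix_vector_scaleR algebra_simps)
    then show ?thesis
      using m by (simp add: sum.distrib sum_subtractf matrix_vector_sum)
  qed
  have hop_diff: "(\<Sum>k=1..L. ?G m k *\<^sub>R (?B k *v x)) - (\<Sum>k=1..L. ?G (Suc m) k *\<^sub>R (?B k *v x)) =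
      - \<delta> *\<^sub>R (?B m *v x) - \<delta> *\<^sub>R (?B (Suc m) *v x)"
  proof -
    \<comment> \<open>Rows \<open>m\<close> and \<open>Suc m\<close> of the coupling agree off the
      dimer. At each of its two sites the averaged diagonal entry leaves half of
      \<open>Gp - Gm\<close>, which is minus \<delta>.\<close>
    have G_diff: "?G m k - ?G (Suc m) k = (if k = m then - \<delta> else 0) - (if k = Suc m then \<delta> else 0)" for k
      using G by (auto simp: coupling_def field_simps)
    have "(\<Sum>k=1..L. ?G m k *\<^sub>R (?B k *v x)) - (\<Sum>k=1..L. ?G (Suc m) k *\<^sub>R (?B k *v x)) =
      (\<Sum>k=1..L. (?G m k - ?G (Suc m) k) *\<^sub>R (?B k *v x))"
      by (simp add: sum_subtractf scaleR_left_diff_distrib)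
    also have "\<dots> = (\<Sum>k=1..L. (if k = m then - \<delta> *\<^sub>R (?B m *v x) else 0)
        - (if k = Suc m then \<delta> *\<^sub>R (?B (Suc m) *v x) else 0))"
      unfolding G_diff by (intro sum.cong) auto
    finally show ?thesis using m by (simp add: sum_subtractf)
  qed
  \<comment> \<open>Annihilating a pair of the dimer gives \<open>x\<close> with opposite signs at
    its two levels, so the extra term is the difference of rows computed in
    \<open>hop_diff\<close>.\<close>
  have hop: "(\<Sum>j=1..L. \<Sum>k=1..L. ?G j k *\<^sub>R (?B k *v (?A j *v (?D *v x)))) =
      ?D *v (\<Sum>j=1..L. \<Sum>k=1..L. ?G j k *\<^sub>R (?B k *v (?A j *v x)))
      + (- \<delta> *\<^sub>R (?B m *v x) - \<delta> *\<^sub>R (?B (Suc m) *v x))"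
  proof -
    have "(\<Sum>j=1..L. \<Sum>k=1..L. ?G j k *\<^sub>R (?B k *v (?A j *v (?D *v x)))) =
      (\<Sum>j=1..L. ?D *v (\<Sum>k=1..L. ?G j k *\<^sub>R (?B k *v (?A j *v x)))
        + ((if j = m then \<Sum>k=1..L. ?G m k *\<^sub>R (?B k *v x) else 0)
         - (if j = Suc m then \<Sum>k=1..L. ?G (Suc m) k *\<^sub>R (?B k *v x) else 0)))"
      using m un by (intro sum.cong refl)
        (auto simp: pair_annihilation_dimer_creation pair_creation_dimer_creation
          matrix_vector_linear matrix_vector_sum sum.distrib sum_subtractf algebra_simps sum_negf)
    then show ?thesis
      using m hop_diff by (simp add: sum.distrib sum_subtractf matrix_vector_sum)
  qed
  \<comment> \<open>The hopping part is subtracted, so it raises the first coefficient and lowers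
    the second by \<delta>. Both become the sum of the two level energies, and the dimer factors
    out.\<close>
  have e: "2 * ?e m + \<delta> = 2 * (\<delta> * (real m - real L / 2))"
    "2 * ?e (Suc m) - \<delta> = 2 * (\<delta> * (real m - real L / 2))"
    by (simp_all add: level_energy_def field_simps)
  have "pairing_hamiltonian L \<delta> Gp Gm c *v (?D *v x) =
    ?D *v (pairing_hamiltonian L \<delta> Gp Gm c *v x)
    + ((2 * ?e m + \<delta>) *\<^sub>R (?B m *v x) - (2 * ?e (Suc m) - \<delta>) *\<^sub>R (?B (Suc m) *v x))"
    unfolding pairing_hamiltonian_apply diag hop
    by (simp add: matrix_vector_mult_diff_distrib scaleR_left_diff_distrib scaleR_left_distrib)
  then show ?thesis
    unfolding e by (simp add: dimer_creation_apply scaleR_right_diff_distrib)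
qed

text \<open>Dimers are added one at a time. The last conjunct strengthens the induction: it records
  which levels are still empty, as the next dimer requires.\<close>

lemma dimer_eigenvector:
  assumes G: "Gp - Gm = - 2 * \<delta>"
    and S: "finite S" "S \<subseteq> {1..L - 1}" "\<forall>i\<in>S. Suc i \<notin> S"
  shows "\<exists>\<psi>\<in>pair_sector L (card S) c vac. \<psi> \<noteq> 0
    \<and> pairing_hamiltonian L \<delta> Gp Gm c *v \<psi> = (2 * (\<Sum>k\<in>S. \<delta> * (real k - real L / 2))) *\<^sub>R \<psi>
    \<and> (\<forall>j\<in>{1..L}. j \<notin> S \<longrightarrow> j \<notin> Suc ` S \<longrightarrow> unoccupied j \<psi>)"
  using S
proof (induction S rule: finite_induct)
  case empty
  have "pairing_hamiltonian L \<delta> Gp Gm c *v vac = 0"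
    unfolding pairing_hamiltonian_apply
    by (simp add: unoccupied_number_op unoccupied_pair_annihilation unoccupied_vac)
  moreover have "vac \<in> pair_sector L 0 c vac"
    using pair_state_mem_pair_sector[of "[]"] by simp
  ultimately show ?case
    using vac_nonzero by (intro bexI[of _ vac]) (auto intro: unoccupied_vac)
next
  case (insert m S)
  have "S \<subseteq> {1..L - 1}" "\<forall>i\<in>S. Suc i \<notin> S"
    using insert.prems by auto
  from insert.IH[OF this] obtain \<phi> where \<phi>: "\<phi> \<in> pair_sector L (card S) c vac" "\<phi> \<noteq> 0"
    "pairing_hamiltonian L \<delta> Gp Gm c *v \<phi> = (2 * (\<Sum>k\<in>S. \<delta> * (real k - real L / 2))) *\<^sub>R \<phi>"
    "\<forall>j\<in>{1..L}. j \<notin> S \<longrightarrow> j \<notin> Suc ` S \<longrightarrow> unoccupied j \<phi>"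
    by blast
  have m: "m \<in> {1..L}" "Suc m \<in> {1..L}"
    using insert.prems by auto
  \<comment> \<open>Together with \<open>m\<close> not being in \<open>S\<close>, this says that the
    new dimer shares no level with the earlier ones.\<close>
  have "m \<notin> Suc ` S" "Suc m \<notin> S" "Suc m \<notin> Suc ` S"
    using insert.prems(2) insert.hyps(2) by auto
  then have un: "unoccupied m \<phi>" "unoccupied (Suc m) \<phi>"
    using \<phi>(4) m insert.hyps(2) by blast+
  let ?\<psi> = "dimer_creation m *v \<phi>"
  have "?\<psi> \<in> pair_sector L (card (insert m S)) c vac"
    using insert.hyps m \<phi>(1) by (simp add: dimer_creation_apply vec.subspace_diff
        subspace_pair_sector pair_creation_mem_pair_sector)
  \<comment> \<open>Removing the pair at \<open>m\<close> recovers the previous state, so the new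
    state cannot vanish.\<close>
  moreover have "(pair_creation c m)\<^sup>\<dagger> *v ?\<psi> = \<phi>"
    using m un by (simp add: pair_annihilation_dimer_creation unoccupied_pair_annihilation)
  then have "?\<psi> \<noteq> 0" using \<phi>(2) by auto
  moreover have "pairing_hamiltonian L \<delta> Gp Gm c *v ?\<psi> =
      (2 * (\<Sum>k\<in>insert m S. \<delta> * (real k - real L / 2))) *\<^sub>R ?\<psi>"
    using insert.hyps
    by (simp add: pairing_hamiltonian_dimer_creation[OF m un G] \<phi>(3) matrix_vector_scaleR
        distrib_left scaleR_left_distrib)
  moreover have "unoccupied j ?\<psi>" if "j \<in> {1..L}" "j \<notin> insert m S" "j \<notin> Suc ` insert m S" for j
    using that m \<phi>(4)
    by (auto simp: dimer_creation_apply intro!: unoccupied_diff unoccupied_pair_creation)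
  ultimately show ?case by blast
qed

lemma eigenvalue_on_deconfined_excitation:
  assumes "\<delta> > 0" "Gp - Gm = - 2 * \<delta>" "T \<in> deconfined_excitations L \<delta> M"
  shows "eigenvalue_on (pairing_hamiltonian L \<delta> Gp Gm c) (pair_sector L M c vac)
    (of_real (2 * (\<Sum>v\<in>T. v)))"
proof -
  let ?v = "\<lambda>k. \<delta> * (real k - real L / 2)"
  obtain S where S: "S \<in> sparse_subsets (L - 1) M" "T = ?v ` S"
    using assms(3) unfolding deconfined_excitations_eq[OF assms(1)] by (rule imageE)
  have "inj_on ?v S"
    using assms(1) by (auto simp: inj_on_def)
  then have sum: "(\<Sum>v\<in>T. v) = (\<Sum>k\<in>S. ?v k)"
    unfolding S(2) by (rule sum.reindex[unfolded comp_def])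
  have "finite S" "S \<subseteq> {1..L - 1}" "\<forall>i\<in>S. Suc i \<notin> S" and card: "card S = M"
    using S(1) finite_of_mem_sparse_subsets[OF S(1)] unfolding sparse_subsets_def by blast+
  from dimer_eigenvector[OF assms(2) this(1-3)] show ?thesis
    unfolding eigenvalue_on_def card sum scaleR_eq_smult by blast
qed

end

theorem proposition1:
  fixes L :: nat and \<delta> Gp Gm :: real
  assumes "L \<ge> 1" and "\<delta> > 0" and "Gp > 0" and "Gm > 0"
    and "Gp - Gm = 2 * \<delta> \<or> Gp - Gm = - 2 * \<delta>"
  shows
    "(\<forall>(c :: nat \<Rightarrow> spin \<Rightarrow> complex^'n^'n) vac. fermionic_fock_space L c vac \<longrightarrow>
        (\<forall>M\<ge>1. \<forall>T \<in> deconfined_excitations L \<delta> M.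
           eigenvalue_on (pairing_hamiltonian L \<delta> Gp Gm c) (pair_sector L M c vac)
             (of_real (2 * (\<Sum>v\<in>T. v)))))
   \<and> (\<forall>M. 1 \<le> M \<and> real M \<le> real L / 2 \<longrightarrow>
        real (card (deconfined_excitations L \<delta> M)) =
          fact (L - M) / (fact (L - 2 * M) * fact M))
   \<and> (\<forall>M. real M > real L / 2 \<longrightarrow> deconfined_excitations L \<delta> M = {})"
proof (intro conjI allI impI ballI)
  fix c :: "nat \<Rightarrow> spin \<Rightarrow> complex^'n^'n" and vac M T
  assume "fermionic_fock_space L c vac" and M: "1 \<le> M" and T: "T \<in> deconfined_excitations L \<delta> M"
  then interpret fermionic_fock_space L c vac by simp
  show "eigenvalue_on (pairing_hamiltonian L \<delta> Gp Gm c) (pair_sector L M c vac)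
      (of_real (2 * (\<Sum>v\<in>T. v)))"
    using assms(5)
  proof
    assume "Gp - Gm = 2 * \<delta>"
    then have "Gm - Gp = - 2 * \<delta>" by simp
    \<comment> \<open>The adjoint has interchanged couplings and hence the sign already solved; the
      energy is real, so it equals its conjugate.\<close>
    from eigenvalue_on_deconfined_excitation[OF assms(2) this T]
    have "eigenvalue_on ((pairing_hamiltonian L \<delta> Gp Gm c)\<^sup>\<dagger>)
        (pair_sector L M c vac) (cnj (of_real (2 * (\<Sum>v\<in>T. v))))"
      by (simp only: dagger_pairing_hamiltonian complex_cnj_complex_of_real)
    with pairing_hamiltonian_mem_pair_sector[OF _ M] show ?thesis
      by (rule eigenvalue_on_of_dagger[OF subspace_pair_sector])
  qed (rule eigenvalue_on_deconfined_excitation[OF assms(2) _ T])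
next
  fix M assume "1 \<le> M \<and> real M \<le> real L / 2"
  then have "2 * M \<le> L" by linarith
  \<comment> \<open>The first inequality permits the factorial form of the binomial
    coefficient.\<close>
  then have M: "M \<le> L - M" "L - M - M = L - 2 * M" by auto
  show "real (card (deconfined_excitations L \<delta> M)) =
      fact (L - M) / (fact (L - 2 * M) * fact M)"
    unfolding card_deconfined_excitations[OF assms(2,1)] binomial_fact[OF M(1)] M(2)
    by (simp only: mult.commute)
next
  fix M assume "real M > real L / 2"
  \<comment> \<open>With truncated subtraction this also covers \<open>M > L\<close>, where the left
    side is 0.\<close>
  then have "L - M < M" by linarith
  then have "card (deconfined_excitations L \<delta> M) = 0"
    by (simp only: card_deconfined_excitations[OF assms(2,1)] binomial_eq_0)
  then show "deconfined_excitations L \<delta> M = {}"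
    unfolding card_0_eq[OF finite_deconfined_excitations[OF assms(2)]] .
qed

end
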